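(* Let $d$ be a positive integer and $\Delta$ an integer with $\Delta\geq 6.21d$. Every $d$-degenerate graph $G$ with $\Delta(G)\leq \Delta$ has an equitable $\Delta$-coloring.
   Context: All graphs are finite and simple. A graph is $d$-degenerate if every subgraph of it has a vertex of degree at most $d$. $\Delta(G)$ denotes the maximum degree of $G$. An equitable $r$-coloring of a graph is a partition of its vertex set into $r$ independent sets $V_1,\dots,V_r$ (some possibly empty) with $\big||V_i|-|V_j|\big|\leq 1$ for all $i,j$. *)

theory Defs
  imports Complex_Main
begin

definition simple_graph :: "'a set \<Rightarrow> ('a \<Rightarrow> 'a \<Rightarrow> bool) \<Rightarrow> bool" where
  "simple_graph V E \<longleftrightarrow> finite V \<and> (\<forall>u v. E u v \<longrightarrow> u \<in> V \<and> v \<in> V)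
     \<and> (\<forall>u v. E u v \<longrightarrow> E v u) \<and> (\<forall>v. \<not> E v v)"

definition degree :: "'a set \<Rightarrow> ('a \<Rightarrow> 'a \<Rightarrow> bool) \<Rightarrow> 'a \<Rightarrow> nat" where
  "degree V E v = card {u \<in> V. E v u}"

definition subgraph :: "'a set \<Rightarrow> ('a \<Rightarrow> 'a \<Rightarrow> bool) \<Rightarrow> 'a set \<Rightarrow> ('a \<Rightarrow> 'a \<Rightarrow> bool) \<Rightarrow> bool" where
  "subgraph W F V E \<longleftrightarrow> W \<subseteq> V \<and> simple_graph W F \<and> (\<forall>u v. F u v \<longrightarrow> E u v)"

definition degenerate :: "nat \<Rightarrow> 'a set \<Rightarrow> ('a \<Rightarrow> 'a \<Rightarrow> bool) \<Rightarrow> bool" where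
  "degenerate d V E \<longleftrightarrow> (\<forall>W F. subgraph W F V E \<and> W \<noteq> {} \<longrightarrow> (\<exists>v\<in>W. degree W F v \<le> d))"

definition max_degree_le :: "'a set \<Rightarrow> ('a \<Rightarrow> 'a \<Rightarrow> bool) \<Rightarrow> nat \<Rightarrow> bool" where
  "max_degree_le V E D \<longleftrightarrow> (\<forall>v\<in>V. degree V E v \<le> D)"

definition equitable_coloring :: "'a set \<Rightarrow> ('a \<Rightarrow> 'a \<Rightarrow> bool) \<Rightarrow> nat \<Rightarrow> ('a \<Rightarrow> nat) \<Rightarrow> bool" where
  "equitable_coloring V E r c \<longleftrightarrow>
     (\<forall>v\<in>V. c v < r) \<and> (\<forall>u\<in>V. \<forall>v\<in>V. E u v \<longrightarrow> c u \<noteq> c v) \<and>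
     (\<forall>i<r. \<forall>j<r. card {v\<in>V. c v = i} \<le> card {v\<in>V. c v = j} + 1)"

end

theory Submission
  imports Defs "HOL-Library.Transitive_Closure_Table"
begin

text \<open>
  Vertices are added one at a time, each new vertex \<open>x\<close> having at most \<open>d\<close> neighbours among the
  present ones. Let the classes have sizes \<open>s\<close> and \<open>s + 1\<close>, and suppose that \<open>x\<close> cannot be
  accommodated. Write \<open>i \<rightarrow> j\<close> if some vertex of class \<open>i\<close> has no neighbour in class \<open>j\<close>. Vertices can be
  shifted along paths, so \<open>x\<close> has a neighbour in each of the \<open>a \<le> d\<close> classes (the set \<open>A\<close>) from which
  a class of size \<open>s\<close> can be reached, and every vertex outside \<open>A\<close> has a neighbour in each class of \<open>A\<close>.
  Let \<open>F\<close> consist of \<open>f = k - d\<close> classes without neighbours of \<open>x\<close> and let \<open>Z\<close> be a class of size \<open>s\<close>.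
  A vertex of \<open>F\<close> is a solo neighbour of \<open>z \<in> Z\<close> if \<open>z\<close> is its only neighbour in \<open>Z\<close>.

  If \<open>y, y'\<close> are nonadjacent solo neighbours of \<open>z\<close>, and either \<open>y\<close> is the only neighbour of \<open>z\<close>
  in its class or the class of \<open>y\<close> can be reached within \<open>F\<close> from a class without neighbours of \<open>z\<close>,
  then moving \<open>y, y'\<close> into \<open>Z\<close>, \<open>z\<close> out of \<open>Z\<close> and \<open>x\<close> into the class of \<open>y'\<close> (after a shift in
  the second case) gives the coloring. So such solo neighbours form cliques, which have at most
  \<open>d + 1\<close> vertices.

  A set of \<open>p\<close> classes of \<open>F\<close> that no other class of \<open>F\<close> can enter forces \<open>p (f - p) + a f \<le> d (f + a)\<close>
  by counting edges. Hence \<open>p\<close> or \<open>f - p\<close> is at most \<open>T = 1.36 d - 1.15 a\<close>, and there is a largest such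
  set \<open>R\<close> with at most \<open>T\<close> classes. Double counting the edges at \<open>Z\<close> gives \<open>z\<close> with many solo neighbours
  outside \<open>R\<close> and few other neighbours in \<open>F\<close>. If the classes without neighbours of \<open>z\<close> reach all of
  \<open>F - R\<close>, there is a clique of size \<open>d + 2\<close>. Otherwise at most \<open>T\<close> classes of \<open>F\<close> avoid \<open>z\<close>, all but
  few of the others contain two neighbours of \<open>z\<close>, and \<open>z\<close> has degree more than \<open>k\<close>.
\<close>

subsection \<open>Recoloring\<close>

definition cls :: "'a set \<Rightarrow> ('a \<Rightarrow> nat) \<Rightarrow> nat \<Rightarrow> 'a set" where
  "cls X c j = {v \<in> X. c v = j}"

definition proper :: "'a set \<Rightarrow> ('a \<Rightarrow> 'a \<Rightarrow> bool) \<Rightarrow> nat \<Rightarrow> ('a \<Rightarrow> nat) \<Rightarrow> bool" where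
  "proper X E k c \<longleftrightarrow> (\<forall>v\<in>X. c v < k) \<and> (\<forall>u\<in>X. \<forall>v\<in>X. E u v \<longrightarrow> c u \<noteq> c v)"

definition movable :: "'a set \<Rightarrow> ('a \<Rightarrow> 'a \<Rightarrow> bool) \<Rightarrow> ('a \<Rightarrow> nat) \<Rightarrow> nat \<Rightarrow> nat \<Rightarrow> bool" where
  "movable X E c i j \<longleftrightarrow> (\<exists>w\<in>cls X c i. \<forall>v\<in>cls X c j. \<not> E w v)"

lemma card_cls_upd:
  assumes "finite X" "v \<in> X"
  shows "card (cls X (c(v := j)) m) + of_bool (c v = m) = card (cls X c m) + of_bool (j = m)"
proof -
  let ?K = "cls (X - {v}) c m"
  have f: "finite ?K" "v \<notin> ?K"
    using assms by (auto simp: cls_def)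
  have "cls X (c(v := j)) m = (if j = m then insert v ?K else ?K)"
    "cls X c m = (if c v = m then insert v ?K else ?K)"
    using assms by (auto simp: cls_def)
  then show ?thesis
    using f by (auto simp: card_insert_if)
qed

lemma card_cls_insert:
  assumes "finite X" "v \<notin> X"
  shows "card (cls (insert v X) c m) = card (cls X c m) + of_bool (c v = m)"
proof -
  have "cls (insert v X) c m = (if c v = m then insert v (cls X c m) else cls X c m)"
    by (auto simp: cls_def)
  then show ?thesis
    using assms by (auto simp: cls_def)
qed

lemma cls_upd_notin: "v \<notin> X \<Longrightarrow> cls X (c(v := j)) m = cls X c m"
  by (auto simp: cls_def)

lemma proper_upd:
  assumes "proper X E k c" "symp E" "irreflp E" "j < k" "\<And>u. u \<in> cls X c j \<Longrightarrow> \<not> E v u"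
  shows "proper X E k (c(v := j))"
  using assms unfolding proper_def cls_def by (auto dest: sympD simp: irreflp_def)

lemma proper_insert:
  assumes "proper X E k c" "symp E" "irreflp E" "j < k" "\<And>u. u \<in> cls X c j \<Longrightarrow> \<not> E v u"
  shows "proper (insert v X) E k (c(v := j))"
  using assms unfolding proper_def cls_def by (auto dest: sympD simp: irreflp_def)

lemma proper_subset: "proper X E k c \<Longrightarrow> Y \<subseteq> X \<Longrightarrow> proper Y E k c"
  unfolding proper_def by blast

text \<open>The tail of the path is shifted first, so when \<open>w\<close> enters class
  \<open>i'\<close>, that class has only lost vertices. Distinctness keeps \<open>w\<close> in class
  \<open>i\<close> until then.\<close>

lemma shift_along_path:
  assumes "rtrancl_path r i p j" "distinct (i # p)" "proper X E k c" "finite X" "symp E" "irreflp E"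
    and r: "\<And>a b. r a b \<Longrightarrow> movable X E c a b \<and> b < k"
  shows "\<exists>c'. proper X E k c' \<and>
    (\<forall>v\<in>X. c' v \<noteq> c v \<longrightarrow> (\<exists>m. r (c v) m) \<and> (\<exists>m. r m (c' v)) \<and> c v \<in> set (i # p) \<and> c' v \<in> set p) \<and>
    cls X c' i \<subseteq> cls X c i \<and>
    (\<forall>m. card (cls X c' m) + of_bool (i = m) = card (cls X c m) + of_bool (j = m))"
  using assms(1,2)
proof (induction rule: rtrancl_path.induct)
  case (base i)
  show ?case by (rule exI[of _ c]) (use assms in auto)
next
  case (step i i' p j)
  obtain c1 where p1: "proper X E k c1"
    and ch: "\<And>v. v \<in> X \<Longrightarrow> c1 v \<noteq> c v \<Longrightarrow> (\<exists>m. r (c v) m) \<and> (\<exists>m. r m (c1 v)) \<and> c v \<in> set (i' # p) \<and> c1 v \<in> set p"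
    and sub: "cls X c1 i' \<subseteq> cls X c i'"
    and cd: "\<And>m. card (cls X c1 m) + of_bool (i' = m) = card (cls X c m) + of_bool (j = m)"
    using step.IH step.prems by auto
  obtain w where w: "w \<in> X" "c w = i" and nw: "\<And>v. v \<in> cls X c i' \<Longrightarrow> \<not> E w v" and i': "i' < k"
    using r[OF step.hyps(1)] unfolding movable_def cls_def by blast
  have c1w: "c1 w = i"
    using ch[OF w(1)] w(2) step.prems by force
  let ?c = "c1(w := i')"
  have "proper X E k ?c"
    by (rule proper_upd[OF p1]) (use assms sub nw i' in auto)
  moreover have "(\<exists>m. r (c v) m) \<and> (\<exists>m. r m (?c v)) \<and> c v \<in> set (i # i' # p) \<and> ?c v \<in> set (i' # p)"
    if "v \<in> X" "?c v \<noteq> c v" for v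
    using ch[OF that(1)] that w step.hyps(1) by (cases "v = w") auto
  moreover have "cls X ?c i \<subseteq> cls X c i"
    using ch step.prems unfolding cls_def by (auto split: if_splits) (metis)
  moreover have "card (cls X ?c m) + of_bool (i = m) = card (cls X c m) + of_bool (j = m)" for m
    using card_cls_upd[OF assms(4) w(1), of c1 i' m] cd[of m] c1w by simp
  ultimately show ?case
    by (intro exI[of _ ?c]) blast
qed

lemma shift_along_rtranclp:
  assumes "r\<^sup>*\<^sup>* i j" "proper X E k c" "finite X" "symp E" "irreflp E"
    and "\<And>a b. r a b \<Longrightarrow> movable X E c a b \<and> b < k"
  obtains c' where "proper X E k c'"
    "\<And>v. v \<in> X \<Longrightarrow> c' v \<noteq> c v \<Longrightarrow> (\<exists>m. r (c v) m) \<and> (\<exists>m. r m (c' v))"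
    "cls X c' i \<subseteq> cls X c i"
    "\<And>m. card (cls X c' m) + of_bool (i = m) = card (cls X c m) + of_bool (j = m)"
proof -
  obtain p where "rtrancl_path r i p j" "distinct (i # p)"
    using assms(1) rtrancl_path_distinct unfolding rtranclp_eq_rtrancl_path by metis
  from shift_along_path[OF this assms(2-5)] assms(6) that show thesis by meson
qed

text \<open>\<open>y\<close> and \<open>y'\<close> enter the class of \<open>z\<close>, then
  \<open>z\<close> enters class \<open>i\<close>, where only \<open>y\<close> could conflict, and
  \<open>x\<close> enters the class left by \<open>y'\<close>. The case \<open>i = c y\<close> is
  allowed.\<close>

lemma swap_and_insert:
  assumes fin: "finite X" and E: "symp E" "irreflp E" and pr: "proper X E k c" and x: "x \<notin> X"
    and z: "z \<in> X" and y: "y \<in> X" "y' \<in> X" "y \<noteq> y'" "\<not> E y y'"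
    and col: "c y \<noteq> c z" "c y' \<noteq> c z" "i < k" "i \<noteq> c z" "i \<noteq> c y'"
    and Ny: "\<And>u. u \<in> cls X c (c z) \<Longrightarrow> E y u \<Longrightarrow> u = z"
    and Ny': "\<And>u. u \<in> cls X c (c z) \<Longrightarrow> E y' u \<Longrightarrow> u = z"
    and Nz: "\<And>u. u \<in> cls X c i \<Longrightarrow> E z u \<Longrightarrow> u = y"
    and Nx: "\<And>u. u \<in> cls X c (c y') \<Longrightarrow> \<not> E x u"
  shows "\<exists>c'. proper (insert x X) E k c' \<and>
    (\<forall>m. card (cls (insert x X) c' m) + of_bool (c y = m) =
      card (cls X c m) + of_bool (i = m) + of_bool (c z = m))"
proof -
  \<comment> \<open>\<open>z\<close> is set aside first: \<open>y\<close> and \<open>y'\<close> may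
    be adjacent to it, and every intermediate coloring has to be proper.\<close>
  define X' where "X' = X - {z}"
  define q where "q = c z"
  define c1 where "c1 = c(y := q)"
  define c2 where "c2 = c1(y' := q)"
  define c3 where "c3 = c2(z := i)"
  define c4 where "c4 = c3(x := c y')"
  have X: "X = insert z X'" "z \<notin> X'" "finite X'" "y \<in> X'" "y' \<in> X'"
    using z fin y col by (auto simp: X'_def)
  have k: "q < k" "c y' < k"
    using pr z y by (auto simp: proper_def q_def)
  have p0: "proper X' E k c"
    using proper_subset[OF pr] X by blast
  have p1: "proper X' E k c1"
    unfolding c1_def
    by (rule proper_upd[OF p0 E k(1)]) (use Ny X in \<open>auto simp: cls_def q_def\<close>)
  have p2: "proper X' E k c2"
    unfolding c2_def
  proof (rule proper_upd[OF p1 E k(1)])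
    fix u assume "u \<in> cls X' c1 q"
    then have "u = y \<or> u \<in> cls X c (c z) \<and> u \<noteq> z"
      using X by (auto simp: cls_def c1_def q_def split: if_splits)
    then show "\<not> E y' u"
      using Ny' y(4) E(1) by (auto dest: sympD)
  qed
  have p3: "proper X E k c3"
    unfolding c3_def X(1)
  proof (rule proper_insert[OF p2 E col(3)])
    fix u assume "u \<in> cls X' c2 i"
    then have "u \<noteq> y" "u \<in> cls X c i"
      using X col by (auto simp: cls_def c1_def c2_def q_def split: if_splits)
    then show "\<not> E z u"
      using Nz by blast
  qed
  have p4: "proper (insert x X) E k c4"
    unfolding c4_def
  proof (rule proper_insert[OF p3 E k(2)])
    fix u assume "u \<in> cls X c3 (c y')"
    then have "u \<in> cls X c (c y')"
      using col by (auto simp: cls_def c1_def c2_def c3_def q_def split: if_splits)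
    then show "\<not> E x u"
      using Nx by blast
  qed
  have "card (cls (insert x X) c4 m) + of_bool (c y = m) =
      card (cls X c m) + of_bool (i = m) + of_bool (q = m)" for m
  proof -
    have "card (cls (insert x X) c4 m) = card (cls X c3 m) + of_bool (c y' = m)"
      using card_cls_insert[OF fin x, of c4 m] cls_upd_notin[OF x] by (simp add: c4_def)
    moreover have "card (cls X c3 m) = card (cls X' c2 m) + of_bool (i = m)"
      using card_cls_insert[OF X(3,2), of c3 m] cls_upd_notin[OF X(2)] by (simp add: c3_def X(1))
    moreover have "card (cls X' c2 m) + of_bool (c y' = m) = card (cls X' c1 m) + of_bool (q = m)"
      using card_cls_upd[OF X(3,5), of c1 q m] y(3) by (simp add: c2_def c1_def)
    moreover have "card (cls X' c1 m) + of_bool (c y = m) = card (cls X' c m) + of_bool (q = m)"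
      using card_cls_upd[OF X(3,4), of c q m] by (simp add: c1_def)
    moreover have "card (cls X c m) = card (cls X' c m) + of_bool (q = m)"
      using card_cls_insert[OF X(3,2), of c m] by (simp add: X(1) q_def)
    ultimately show ?thesis by linarith
  qed
  with p4 show ?thesis unfolding q_def by blast
qed

text \<open>The path is cut at its first visit to \<open>Q\<close>.\<close>

lemma rtranclp_avoiding_targets:
  assumes "r\<^sup>*\<^sup>* i j" "j \<in> Q"
  shows "\<exists>j'\<in>Q. (\<lambda>a b. r a b \<and> a \<notin> Q)\<^sup>*\<^sup>* i j'"
  using assms(1)
proof (induction rule: converse_rtranclp_induct)
  case base
  then show ?case using assms(2) by blast
next
  case (step a b)
  then show ?case
    by (cases "a \<in> Q") (auto intro: converse_rtranclp_into_rtranclp)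
qed

subsection \<open>Counting in degenerate graphs\<close>

lemma sum_card_fibres_le:
  assumes "finite M" "finite H"
  shows "(\<Sum>j\<in>H. card {v \<in> M. c v = j}) \<le> card M"
proof -
  have "(\<Sum>j\<in>H. card {v \<in> M. c v = j}) = card (\<Union>j\<in>H. {v \<in> M. c v = j})"
    using assms by (subst card_UN_disjoint) auto
  also have "\<dots> \<le> card M"
    using assms by (intro card_mono) auto
  finally show ?thesis .
qed

text \<open>\<open>T\<close> holds at most one orientation of each edge. Delete a vertex
  \<open>v\<close> of degree at most \<open>d\<close>: the pairs of \<open>T\<close> at
  \<open>v\<close> inject into its neighbors, and induction handles the rest.\<close>

lemma oriented_edges_le:
  assumes "finite S" and sym: "symp E"
    and degen: "\<And>W. W \<subseteq> S \<Longrightarrow> W \<noteq> {} \<Longrightarrow> \<exists>v\<in>W. card {u \<in> W. E v u} \<le> d"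
    and "T \<subseteq> S \<times> S" "\<And>u v. (u, v) \<in> T \<Longrightarrow> E u v \<and> (v, u) \<notin> T"
  shows "card T \<le> d * card S"
  using assms(1,3-)
proof (induction "card S" arbitrary: S T)
  case 0
  then show ?case by simp
next
  case (Suc n)
  then have "S \<noteq> {}" by auto
  then obtain v where v: "v \<in> S" "card {u \<in> S. E v u} \<le> d"
    using Suc.prems(2)[of S] by blast
  define T1 where "T1 = {p \<in> T. fst p \<noteq> v \<and> snd p \<noteq> v}"
  define T2 where "T2 = {p \<in> T. fst p = v \<or> snd p = v}"
  have fT: "finite T"
    using Suc.prems(1,3) finite_subset by blast
  have "card T1 \<le> d * card (S - {v})"
  proof (rule Suc.hyps(1))
    show "n = card (S - {v})" using Suc.hyps(2) v Suc.prems(1) by simp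
    show "\<And>W. W \<subseteq> S - {v} \<Longrightarrow> W \<noteq> {} \<Longrightarrow> \<exists>v\<in>W. card {u \<in> W. E v u} \<le> d"
      using Suc.prems(2) by blast
    show "T1 \<subseteq> (S - {v}) \<times> (S - {v})" using Suc.prems(3) by (auto simp: T1_def)
    show "\<And>u w. (u, w) \<in> T1 \<Longrightarrow> E u w \<and> (w, u) \<notin> T1" using Suc.prems(4) by (auto simp: T1_def)
  qed (use Suc.prems in auto)
  moreover have "card T2 \<le> card {u \<in> S. E v u}"
  proof (rule card_inj_on_le)
    show "inj_on (\<lambda>(a, b). if a = v then b else a) T2"
      using Suc.prems(4) by (force simp: inj_on_def T2_def split: if_splits)
    show "(\<lambda>(a, b). if a = v then b else a) ` T2 \<subseteq> {u \<in> S. E v u}"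
      using Suc.prems(3,4) sym by (fastforce simp: T2_def dest: sympD)
  qed (use Suc.prems in auto)
  moreover have "T = T1 \<union> T2" "T1 \<inter> T2 = {}"
    by (auto simp: T1_def T2_def)
  then have "card T = card T1 + card T2"
    using fT by (metis card_Un_disjoint finite_Un)
  moreover have "card S = Suc (card (S - {v}))"
    using v Suc.prems(1) by (metis card_Suc_Diff1)
  ultimately show ?case
    using v(2) by simp
qed

lemma clique_card_le:
  assumes "finite Q" "irreflp E"
    and degen: "\<And>W. W \<subseteq> Q \<Longrightarrow> W \<noteq> {} \<Longrightarrow> \<exists>v\<in>W. card {u \<in> W. E v u} \<le> d"
    and cl: "\<And>u v. u \<in> Q \<Longrightarrow> v \<in> Q \<Longrightarrow> u \<noteq> v \<Longrightarrow> E u v"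
  shows "card Q \<le> d + 1"
proof (cases "Q = {}")
  case False
  then obtain v where v: "v \<in> Q" "card {u \<in> Q. E v u} \<le> d"
    using degen[of Q] by blast
  have "{u \<in> Q. E v u} = Q - {v}"
    using cl v(1) assms(2) by (auto simp: irreflp_def)
  then show ?thesis
    using v assms(1) by (simp add: card_Diff_singleton)
qed simp

lemma in_closed_dichotomy:
  fixes a d f p :: real
  assumes "1 \<le> a" "a \<le> d" "5.21 * d \<le> f" "p * (f - p) + a * f \<le> d * (f + a)"
  shows "p \<le> 1.36 * d - 1.15 * a \<or> f - p \<le> 1.36 * d - 1.15 * a"
proof (rule ccontr)
  define T where "T = 1.36 * d - 1.15 * a"
  assume "\<not> ?thesis"
  \<comment> \<open>This product equals \<open>p * (f - p) - T * (f - T)\<close>.\<close>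
  then have "0 < (p - T) * (f - p - T)"
    by (simp add: T_def)
  then have 1: "T * (f - T) < p * (f - p)"
    by (simp add: algebra_simps)
  have "(T - (d - a)) * (f - 5.21 * d) \<ge> 0"
    using assms by (intro mult_nonneg_nonneg) (auto simp: T_def)
  \<comment> \<open>At \<open>f = 5.21 * d\<close> this is 10000 times the slack in
    \<open>d * (f + a) - a * f \<le> T * (f - T)\<close>.\<close>
  moreover have "260 * (d * d) + 13465 * (a * d) - 13225 * (a * a) \<ge> 0"
  proof -
    have "a * a \<le> a * d" using assms by (intro mult_left_mono) auto
    moreover have "0 \<le> d * d" "0 \<le> a * a" by simp_all
    ultimately show ?thesis by linarith
  qed
  ultimately have "d * (f + a) - a * f \<le> T * (f - T)"
    unfolding T_def by (simp add: algebra_simps)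
  with 1 assms(4) show False by linarith
qed

text \<open>Here \<open>\<rho>\<close> stands for the size of \<open>R\<close> and \<open>u\<close>
  for the number of neighbors of \<open>z\<close> in \<open>F\<close> that are not solo. The bounds
  reduce to a quadratic form in \<open>d\<close> and \<open>a\<close> that is positive
  definite.\<close>

lemma weight_contradiction:
  fixes a d f u T \<rho> :: real
  assumes "1 \<le> a" "a \<le> d" "5.21 * d \<le> f" "T = 1.36 * d - 1.15 * a" "\<rho> \<le> T"
    and "f - 2 * T - 2 * d \<le> u" "(a + d) * u \<le> a * (3 * d + \<rho> + a)"
  shows False
proof -
  have "(a + d) * (0.49 * d + 2.3 * a) \<le> (a + d) * u"
    using assms by (intro mult_left_mono) auto
  moreover have "a * (3 * d + \<rho> + a) \<le> a * (4.36 * d - 0.15 * a)"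
    using assms by (intro mult_left_mono) auto
  moreover have "(a + d) * (0.49 * d + 2.3 * a) - a * (4.36 * d - 0.15 * a) =
      0.49 * (d * d) - 1.57 * (a * d) + 2.45 * (a * a)"
    by (simp add: field_simps)
  ultimately have "0.49 * (d * d) - 1.57 * (a * d) + 2.45 * (a * a) \<le> 0"
    using assms(7) by linarith
  \<comment> \<open>Subtracting 0.3925 times this square from the form removes the mixed term and
    leaves positive coefficients.\<close>
  moreover have "0 \<le> (d - 2 * a) * (d - 2 * a)"
    by simp
  moreover have "0 < a * a"
    using assms by simp
  moreover have "0 < a * d"
    using assms by simp
  moreover have "0 < d * d"
    using assms by simp
  ultimately show False
    by (simp add: algebra_simps)
qed

subsection \<open>A coloring that cannot be extended\<close>

text \<open>\<open>F\<close> has exactly \<open>k - d\<close> classes, so the degree bound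
  \<open>k\<close> reads \<open>card F + d\<close>. \<open>stuck\<close> excludes the colorings in
  which one class of size \<open>s\<close> has grown by one; every exchange below aims at these
  sizes.\<close>

locale stuck_coloring =
  fixes V :: "'a set" and E :: "'a \<Rightarrow> 'a \<Rightarrow> bool" and d k s :: nat
    and x :: 'a and c :: "'a \<Rightarrow> nat" and X :: "'a set" and F :: "nat set" and i0 :: nat
  assumes finV: "finite V" and symE: "symp E" and irrE: "irreflp E"
    and deg: "\<And>v. v \<in> V \<Longrightarrow> card {u \<in> V. E v u} \<le> k"
    and degen: "\<And>W. W \<subseteq> V \<Longrightarrow> W \<noteq> {} \<Longrightarrow> \<exists>v\<in>W. card {u \<in> W. E v u} \<le> d"
    and d: "1 \<le> d" and dk: "6.21 * real d \<le> real k"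
    and V: "V = insert x X" and x: "x \<notin> X"
    and degx: "card {u \<in> V. E x u} \<le> d"
    and proper_c: "proper X E k c"
    and size: "\<And>m. m < k \<Longrightarrow> s \<le> card (cls X c m) \<and> card (cls X c m) \<le> s + 1"
    and i0: "i0 < k" "card (cls X c i0) = s"
    and F: "F \<subseteq> {i. i < k \<and> (\<forall>u\<in>cls X c i. \<not> E x u)}" "card F = k - d"
    and stuck: "\<And>c' j. proper V E k c' \<Longrightarrow> j < k \<Longrightarrow> card (cls X c j) = s \<Longrightarrow>
      (\<And>m. card (cls V c' m) = card (cls X c m) + of_bool (j = m)) \<Longrightarrow> False"
begin

section \<open>Classes from which a small class can be reached\<close>

definition mv :: "nat \<Rightarrow> nat \<Rightarrow> bool" where
  "mv i j \<longleftrightarrow> i < k \<and> j < k \<and> movable X E c i j"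

definition A :: "nat set" where
  "A = {i. i < k \<and> (\<exists>j<k. card (cls X c j) = s \<and> mv\<^sup>*\<^sup>* i j)}"

definition solo :: "'a \<Rightarrow> 'a \<Rightarrow> bool" where
  "solo z v \<longleftrightarrow> {w \<in> cls X c i0. E v w} = {z}"

definition in_closed :: "nat set \<Rightarrow> bool" where
  "in_closed S \<longleftrightarrow> S \<subseteq> F \<and> (\<forall>i\<in>F - S. \<forall>j\<in>S. \<not> mv i j)"

lemma finX: "finite X"
  using finV V by simp

lemma fin_cls: "finite (cls X c m)"
  using finX by (simp add: cls_def)

lemma E_sym: "E u v \<Longrightarrow> E v u"
  using symE by (rule sympD)

lemma col_less: "v \<in> X \<Longrightarrow> c v < k"
  using proper_c by (simp add: proper_def)

lemma finF: "finite F"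
  using F(1) by (rule finite_subset) simp

lemma finA: "finite A"
  by (simp add: A_def)

text \<open>Otherwise a shift along a path from \<open>i\<close> to a class of size
  \<open>s\<close>, followed by adding \<open>x\<close> to class \<open>i\<close>, gives an excluded
  coloring; the shift brings no new vertex into class \<open>i\<close>.\<close>

lemma A_has_neighbor_of_x:
  assumes "i \<in> A"
  shows "\<exists>u\<in>cls X c i. E x u"
proof (rule ccontr)
  assume n: "\<not> ?thesis"
  obtain j where j: "j < k" "card (cls X c j) = s" "mv\<^sup>*\<^sup>* i j" and i: "i < k"
    using assms by (auto simp: A_def)
  obtain c' where c': "proper X E k c'" "cls X c' i \<subseteq> cls X c i"
    "\<And>m. card (cls X c' m) + of_bool (i = m) = card (cls X c m) + of_bool (j = m)"
    by (rule shift_along_rtranclp[OF j(3) proper_c finX symE irrE]) (auto simp: mv_def)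
  show False
  proof (rule stuck[OF _ j(1,2)])
    show "proper V E k (c'(x := i))"
      unfolding V by (rule proper_insert[OF c'(1) symE irrE i]) (use n c'(2) in blast)
    show "card (cls V (c'(x := i)) m) = card (cls X c m) + of_bool (j = m)" for m
      using card_cls_insert[OF finX x, of "c'(x := i)" m] c'(3)[of m]
      by (simp add: V cls_upd_notin[OF x])
  qed
qed

lemma i0_A: "i0 \<in> A"
  using i0 by (auto simp: A_def)

lemma A_F: "A \<inter> F = {}"
  using A_has_neighbor_of_x F(1) by fastforce

lemma card_A: "1 \<le> card A" "card A \<le> d"
proof -
  show "1 \<le> card A"
    using i0_A finA by (metis One_nat_def Suc_leI card_gt_0_iff empty_iff)
  obtain g where g: "\<And>i. i \<in> A \<Longrightarrow> g i \<in> cls X c i \<and> E x (g i)"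
    using A_has_neighbor_of_x by metis
  have "card A \<le> card {u \<in> V. E x u}"
  proof (rule card_inj_on_le)
    show "inj_on g A"
      by (intro inj_onI) (metis (mono_tags, lifting) cls_def g mem_Collect_eq)
    show "g ` A \<subseteq> {u \<in> V. E x u}"
      using g by (auto simp: cls_def V)
  qed (use finV in auto)
  then show "card A \<le> d"
    using degx by simp
qed

lemma cls_not_A:
  assumes "i < k" "i \<notin> A"
  shows "card (cls X c i) = s + 1"
  using assms size[of i] by (force simp: A_def)

text \<open>A vertex \<open>v\<close> without neighbors in class \<open>j\<close> could move there,
  so its own class would reach a small class through \<open>j\<close>.\<close>

lemma not_A_has_neighbor:
  assumes "v \<in> X" "c v \<notin> A" "j \<in> A"
  shows "\<exists>u\<in>cls X c j. E v u"
proof (rule ccontr)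
  assume "\<not> ?thesis"
  then have "mv (c v) j"
    using assms col_less by (auto simp: mv_def movable_def cls_def A_def)
  moreover obtain j' where "j' < k" "card (cls X c j') = s" "mv\<^sup>*\<^sup>* j j'"
    using assms(3) by (auto simp: A_def)
  ultimately have "c v \<in> A"
    using converse_rtranclp_into_rtranclp[of mv "c v" j j'] assms(1) col_less
    unfolding A_def by blast
  with assms show False by simp
qed

lemma solo_memD: "solo z v \<Longrightarrow> z \<in> X \<and> c z = i0 \<and> E v z"
  by (auto simp: solo_def cls_def)

lemma card_colors:
  assumes "S \<subseteq> {..<k}"
  shows "card {v \<in> X. c v \<in> S} = (\<Sum>j\<in>S. card (cls X c j))"
proof -
  have "{v \<in> X. c v \<in> S} = (\<Union>j\<in>S. cls X c j)"
    by (auto simp: cls_def)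
  moreover have "finite S"
    using assms by (rule finite_subset) simp
  ultimately show ?thesis
    by (simp add: card_UN_disjoint fin_cls) (subst card_UN_disjoint; auto simp: cls_def finX)
qed

lemma card_colors_not_A:
  assumes "S \<subseteq> {..<k} - A"
  shows "card {v \<in> X. c v \<in> S} = card S * (s + 1)"
proof -
  have "(\<Sum>j\<in>S. card (cls X c j)) = (\<Sum>j\<in>S. s + 1)"
    using assms by (intro sum.cong) (auto simp: cls_not_A)
  then show ?thesis
    using card_colors[of S] assms by auto
qed

lemma F_sub: "F \<subseteq> {..<k} - A"
  using F(1) A_F by auto

section \<open>Exchanges that make solo neighbors adjacent\<close>

text \<open>Compared with \<open>c\<close>, class \<open>i\<close> is one vertex short and the class
  of \<open>y\<close> has one too many, or \<open>i = c' y\<close> and the sizes agree. If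
  \<open>E y y'\<close> failed, \<open>swap_and_insert\<close> would even this out and enlarge only
  class \<open>i0\<close>.\<close>

lemma solo_pair_exchange:
  assumes pr: "proper X E k c'" and z: "c' z = i0" and solo: "solo z y" "solo z y'"
    and y: "y \<in> X" "y' \<in> X" "y \<noteq> y'" "c' y \<noteq> i0" "c' y' \<noteq> i0"
    and i: "i < k" "i \<noteq> i0" "i \<noteq> c' y'"
    and cls0: "cls X c' i0 = cls X c i0"
    and Nz: "\<And>u. u \<in> cls X c' i \<Longrightarrow> E z u \<Longrightarrow> u = y"
    and Nx: "\<And>u. u \<in> cls X c' (c' y') \<Longrightarrow> \<not> E x u"
    and cd: "\<And>m. card (cls X c' m) + of_bool (i = m) = card (cls X c m) + of_bool (c' y = m)"
  shows "E y y'"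
proof (rule ccontr)
  assume n: "\<not> E y y'"
  have zX: "z \<in> X"
    using solo_memD[OF solo(1)] by simp
  have "\<exists>c''. proper (insert x X) E k c'' \<and>
    (\<forall>m. card (cls (insert x X) c'' m) + of_bool (c' y = m) =
      card (cls X c' m) + of_bool (i = m) + of_bool (c' z = m))"
  proof (rule swap_and_insert[OF finX symE irrE pr x zX y(1,2,3) n])
    fix u assume u: "u \<in> cls X c' (c' z)"
    then have "u \<in> cls X c i0"
      by (simp add: z cls0)
    then show "E y u \<Longrightarrow> u = z" "E y' u \<Longrightarrow> u = z"
      using solo by (auto simp: solo_def)
  qed (use y i z Nz Nx in auto)
  then obtain c'' where c'': "proper V E k c''"
    and c2: "\<And>m. card (cls V c'' m) + of_bool (c' y = m) =
      card (cls X c' m) + of_bool (i = m) + of_bool (i0 = m)"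
    by (auto simp: V z)
  have "card (cls V c'' m) = card (cls X c m) + of_bool (i0 = m)" for m
    using c2[of m] cd[of m] by simp
  then show False
    using stuck[OF c'' i0] by blast
qed

text \<open>No shift is made: \<open>z\<close> takes the place of \<open>y\<close>, its only
  neighbor in that class. As another neighbor of \<open>z\<close>, \<open>y'\<close> lies in a
  different class.\<close>

lemma private_solo_adjacent:
  assumes y: "y \<in> X" "c y \<in> F" "solo z y" and pv: "\<And>u. u \<in> cls X c (c y) \<Longrightarrow> E z u \<Longrightarrow> u = y"
    and y': "y' \<in> X" "c y' \<in> F" "solo z y'" and ne: "y \<noteq> y'"
  shows "E y y'"
proof (rule solo_pair_exchange[OF proper_c _ y(3) y'(3) y(1) y'(1) ne, where i = "c y"])
  show "c z = i0"
    using solo_memD[OF y(3)] by simp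
  show "c y \<noteq> i0" "c y' \<noteq> i0" "c y \<noteq> i0"
    using y y' A_F i0_A by auto
  show "c y < k"
    using y col_less by simp
  show "c y \<noteq> c y'"
    using pv[of y'] y' ne solo_memD[OF y'(3)] E_sym by (auto simp: cls_def)
  show "\<And>u. u \<in> cls X c (c y') \<Longrightarrow> \<not> E x u"
    using F(1) y' by auto
qed (use pv in auto)

definition mvF :: "nat \<Rightarrow> nat \<Rightarrow> bool" where
  "mvF i j \<longleftrightarrow> i \<in> F \<and> j \<in> F \<and> mv i j"

text \<open>After a shift from \<open>i\<close>, \<open>z\<close> can enter class \<open>i\<close>,
  and the departure of \<open>y\<close> restores the size of the last class. If the path meets the
  class of \<open>y'\<close> first, \<open>y\<close> and \<open>y'\<close> change roles.\<close>

lemma reached_solo_adjacent: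
  assumes y: "y \<in> X" "c y \<in> F" "solo z y" and y': "y' \<in> X" "c y' \<in> F" "solo z y'" and ne: "y \<noteq> y'"
    and i: "i \<in> F" "\<And>u. u \<in> cls X c i \<Longrightarrow> \<not> E z u" "mvF\<^sup>*\<^sup>* i (c y)"
  shows "E y y'"
proof -
  define Q where "Q = {c y, c y'}"
  \<comment> \<open>Stopping the path at the first class of \<open>Q\<close> keeps \<open>y\<close> and \<open>y'\<close> in place during the shift.\<close>
  define r where "r = (\<lambda>a b. mvF a b \<and> a \<notin> Q)"
  obtain j where j: "j \<in> Q" "r\<^sup>*\<^sup>* i j"
    using rtranclp_avoiding_targets[OF i(3), of Q] by (auto simp: Q_def r_def)
  obtain c' where pr: "proper X E k c'"
    and ch: "\<And>v. v \<in> X \<Longrightarrow> c' v \<noteq> c v \<Longrightarrow> (\<exists>m. r (c v) m) \<and> (\<exists>m. r m (c' v))"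
    and sub: "cls X c' i \<subseteq> cls X c i"
    and cd: "\<And>m. card (cls X c' m) + of_bool (i = m) = card (cls X c m) + of_bool (j = m)"
    by (rule shift_along_rtranclp[OF j(2) proper_c finX symE irrE]) (auto simp: r_def mvF_def mv_def)
  have zz: "z \<in> X" "c z = i0" "E y z" "E y' z"
    using solo_memD y(3) y'(3) by auto
  have keep: "c' y = c y" "c' y' = c y'"
    using ch[OF y(1)] ch[OF y'(1)] by (auto simp: r_def Q_def)
  have i0F: "i0 \<notin> F"
    using A_F i0_A by auto
  have c0: "c' v = i0 \<longleftrightarrow> c v = i0" if "v \<in> X" for v
    using ch[OF that] i0F unfolding r_def mvF_def by metis
  \<comment> \<open>The shift stays within \<open>F\<close>, so a vertex now colored from
    \<open>F\<close> was so before and is no neighbor of \<open>x\<close>.\<close>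
  have cF: "c v \<in> F" if "v \<in> X" "c' v \<in> F" for v
    using ch[OF that(1)] that(2) unfolding r_def mvF_def by metis
  have iQ: "i \<noteq> c y" "i \<noteq> c y'"
    using i(2) y(1) y'(1) zz E_sym by (auto simp: cls_def)
  have ex: "E a b" if ab: "a \<in> X" "c a \<in> F" "solo z a" "b \<in> X" "c b \<in> F" "solo z b" "a \<noteq> b"
    and cab: "c' a = c a" "c' b = c b" "j = c a" "i \<noteq> c b" for a b
  proof (rule solo_pair_exchange[OF pr _ ab(3,6,1,4,7), where i = i])
    show "c' z = i0" using c0 zz by simp
    show "c' a \<noteq> i0" "c' b \<noteq> i0" "i \<noteq> i0" using ab cab i0F i by auto
    show "i < k" using i F by auto
    show "i \<noteq> c' b" using cab by simp
    show "cls X c' i0 = cls X c i0" using c0 by (auto simp: cls_def)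
    show "\<And>u. u \<in> cls X c' i \<Longrightarrow> E z u \<Longrightarrow> u = a" using sub i(2) by blast
    show "\<not> E x u" if "u \<in> cls X c' (c' b)" for u
    proof -
      have "u \<in> X" "c u \<in> F" using that cF ab cab by (auto simp: cls_def)
      then show ?thesis using F(1) by (auto simp: cls_def)
    qed
    show "card (cls X c' m) + of_bool (i = m) = card (cls X c m) + of_bool (c' a = m)" for m
      using cd[of m] cab by simp
  qed
  show ?thesis
  proof (cases "j = c y")
    case True
    then show ?thesis using ex[OF y y' ne keep] iQ by simp
  next
    case False
    then have "j = c y'" using j by (auto simp: Q_def)
    then show ?thesis using ex[OF y' y ne[symmetric] keep(2,1)] iQ E_sym by simp
  qed
qed

section \<open>Edge counts and the choice of \<open>z\<close>\<close>

text \<open>Each vertex of \<open>F\<close> has a neighbor in every class of \<open>A\<close>, and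
  each vertex of \<open>F - S\<close> has one in every class of \<open>S\<close>.
  \<open>oriented_edges_le\<close> bounds these edges inside \<open>F \<union> A\<close>, and the
  factor \<open>s + 1\<close> cancels.\<close>

lemma in_closed_edges:
  assumes "in_closed S"
  shows "card S * (card F - card S) + card A * card F \<le> d * (card F + card A)"
proof -
  have S: "S \<subseteq> F" using assms by (simp add: in_closed_def)
  define W where "W = {v \<in> X. c v \<in> F \<union> A}"
  define T where "T = {(u, v). u \<in> X \<and> v \<in> X \<and> E u v \<and>
    (c u \<in> F \<and> c v \<in> A \<or> c u \<in> F - S \<and> c v \<in> S)}"
  define P where "P = {v \<in> X. c v \<in> F} \<times> A \<union> {v \<in> X. c v \<in> F - S} \<times> S"
  have nb: "\<exists>w. w \<in> X \<and> c w = j \<and> E u w" if "(u, j) \<in> P" for u j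
  proof -
    have "j \<in> A \<or> \<not> mv (c u) j" "u \<in> X" "c u \<in> F" "j < k"
      using that assms F_sub S by (auto simp: P_def in_closed_def A_def)
    then show ?thesis
      using not_A_has_neighbor[of u j] A_F col_less[of u]
      by (auto simp: mv_def movable_def cls_def)
  qed
  then obtain g where g: "\<And>u j. (u, j) \<in> P \<Longrightarrow> g u j \<in> X \<and> c (g u j) = j \<and> E u (g u j)"
    by metis
  have finW: "finite W" using finX by (simp add: W_def)
  have TW: "T \<subseteq> W \<times> W" using S by (auto simp: T_def W_def)
  have "card T \<le> d * card W"
  proof (rule oriented_edges_le[OF finW symE _ TW])
    show "\<exists>v\<in>U. card {u \<in> U. E v u} \<le> d" if "U \<subseteq> W" "U \<noteq> {}" for U
      using degen[of U] that by (auto simp: W_def V)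
    show "E u v \<and> (v, u) \<notin> T" if "(u, v) \<in> T" for u v
      using that A_F S by (auto simp: T_def)
  qed
  moreover have "card P \<le> card T"
  proof (rule card_inj_on_le)
    show "inj_on (\<lambda>(u, j). (u, g u j)) P"
      using g by (auto simp: inj_on_def) (metis)
    show "(\<lambda>(u, j). (u, g u j)) ` P \<subseteq> T"
      using g by (fastforce simp: T_def P_def)
    show "finite T"
      using TW finW by (meson finite_SigmaI finite_subset)
  qed
  moreover have "card P = (card F * card A + (card F - card S) * card S) * (s + 1)"
  proof -
    have "card P = card ({v \<in> X. c v \<in> F} \<times> A) + card ({v \<in> X. c v \<in> F - S} \<times> S)"
      unfolding P_def
      by (rule card_Un_disjoint) (use finX finA finF S A_F in \<open>auto intro: finite_subset\<close>)
    moreover have "card {v \<in> X. c v \<in> F - S} = (card F - card S) * (s + 1)"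
      using card_colors_not_A[of "F - S"] F_sub S finF
      by (metis Diff_subset card_Diff_subset finite_subset subset_trans)
    ultimately show ?thesis
      using card_colors_not_A[OF F_sub]
      by (simp only: card_cartesian_product distrib_right mult_1 mult_1_right distrib_left)
        (simp only: mult.commute mult.left_commute)
  qed
  moreover have "card W \<le> (card F + card A) * (s + 1)"
  proof -
    have "card W = (\<Sum>j\<in>F \<union> A. card (cls X c j))"
      unfolding W_def using F_sub by (intro card_colors) (auto simp: A_def)
    also have "\<dots> \<le> (\<Sum>j\<in>F \<union> A. s + 1)"
      using size F_sub by (intro sum_mono) (auto simp: A_def)
    also have "\<dots> = (card F + card A) * (s + 1)"
      using card_Un_disjoint[OF finF finA] A_F by (simp add: Int_commute)
    finally show ?thesis .
  qed
  ultimately have "(card F * card A + (card F - card S) * card S) * (s + 1) \<le> d * ((card F + card A) * (s + 1))"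
    by (metis le_trans mult_le_mono2)
  then have "(card F * card A + (card F - card S) * card S) * (s + 1) \<le> (d * (card F + card A)) * (s + 1)"
    by (simp only: mult.assoc)
  then have "card F * card A + (card F - card S) * card S \<le> d * (card F + card A)"
    by (metis add_gr_0 less_one mult_le_cancel2)
  then show ?thesis by (simp add: algebra_simps)
qed

lemma s_pos: "1 \<le> s"
proof -
  have "cls X c i0 \<noteq> {}"
    using A_has_neighbor_of_x[OF i0_A] by auto
  then show ?thesis
    using i0(2) fin_cls[of i0] by (metis One_nat_def Suc_leI card_gt_0_iff)
qed

definition solos :: "nat set \<Rightarrow> 'a \<Rightarrow> 'a set" where
  "solos S z = {v \<in> X. c v \<in> S \<and> solo z v}"

definition nonsolos :: "'a \<Rightarrow> 'a set" where
  "nonsolos z = {v \<in> X. c v \<in> F \<and> E z v \<and> \<not> solo z v}"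

text \<open>At most \<open>s * k\<close> edges meet class \<open>i0\<close>, whereas
  \<open>(k - a) * (s + 1)\<close> vertices lie outside \<open>A\<close>, where
  \<open>a = card A\<close>. The difference is \<open>a * s - (k - a)\<close>.\<close>

lemma excess_le:
  "(\<Sum>v\<in>{v \<in> X. c v \<notin> A}. int (card {w \<in> cls X c i0. E v w}) - 1) \<le> int (card A * s)"
proof -
  define B where "B = {v \<in> X. c v \<notin> A}"
  define Z where "Z = cls X c i0"
  have fin: "finite B" "finite Z"
    using finX fin_cls by (auto simp: B_def Z_def)
  have "B = {v \<in> X. c v \<in> {..<k} - A}"
    using col_less by (auto simp: B_def)
  then have "card B = card ({..<k} - A) * (s + 1)"
    using card_colors_not_A[OF subset_refl] by simp
  moreover have "card ({..<k} - A) = k - card A"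
    using finA by (subst card_Diff_subset) (auto simp: A_def)
  moreover have kA: "card A \<le> k"
    using card_mono[of "{..<k}" A] by (auto simp: A_def)
  ultimately have cB: "int (card B) = (int k - int (card A)) * (int s + 1)"
    by (simp only: of_nat_mult of_nat_diff of_nat_add of_nat_1)
  have "(\<Sum>v\<in>B. card {w \<in> Z. E v w}) = (\<Sum>w\<in>Z. card {v \<in> B. E v w})"
    by (rule sum_multicount_gen[OF fin]) simp
  also have "\<dots> \<le> (\<Sum>w\<in>Z. k)"
  proof (rule sum_mono)
    fix w assume "w \<in> Z"
    then have "w \<in> V" by (auto simp: Z_def cls_def V)
    have "card {v \<in> B. E v w} \<le> card {u \<in> V. E w u}"
      using finV E_sym by (intro card_mono) (auto simp: B_def V)
    with deg[OF \<open>w \<in> V\<close>] show "card {v \<in> B. E v w} \<le> k" by simp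
  qed
  also have "\<dots> = s * k" by (simp add: Z_def i0)
  finally have "(\<Sum>v\<in>B. int (card {w \<in> Z. E v w})) \<le> int s * int k"
    by (metis of_nat_le_iff of_nat_mult of_nat_sum)
  then have "(\<Sum>v\<in>B. int (card {w \<in> Z. E v w}) - 1) \<le> int s * int k - (int k - int (card A)) * (int s + 1)"
    by (simp add: sum_subtractf cB)
  also have "\<dots> \<le> int (card A * s)"
    using kA by (simp add: algebra_simps)
  finally show ?thesis by (simp add: B_def Z_def)
qed

text \<open>Average over class \<open>i0\<close>: the solo neighbors in \<open>F - R\<close> number
  at least the vertices there minus the excess, the other neighbors in \<open>F\<close> at most
  twice the excess, and \<open>excess_le\<close> bounds the excess by
  \<open>card A * s\<close>.\<close>

lemma exists_good_center:
  assumes R: "R \<subseteq> F"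
  shows "\<exists>z\<in>cls X c i0.
    int (card A) * (int (card F) - int (card R) - int (card A) - 2 * int d) \<le>
      int (card A) * int (card (solos (F - R) z)) - int d * int (card (nonsolos z))"
proof (rule ccontr)
  define a f \<rho> where "a = int (card A)" and "f = int (card F)" and "\<rho> = int (card R)"
  define K where "K = a * (f - \<rho> - a - 2 * int d)"
  define Z where "Z = cls X c i0"
  define D where "D v = int (card {w \<in> Z. E v w})" for v
  define W where "W = {v \<in> X. c v \<in> F - R}"
  define U where "U = {v \<in> X. c v \<in> F}"
  have fin: "finite Z" "finite W" "finite U"
    using finX fin_cls by (auto simp: Z_def W_def U_def)
  assume "\<not> ?thesis"
  then have small: "a * int (card (solos (F - R) z)) - int d * int (card (nonsolos z)) < K" if "z \<in> Z" for z
    using that by (auto simp: K_def a_def f_def \<rho>_def Z_def not_le)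
  have D1: "1 \<le> D v" if "v \<in> U" for v
  proof -
    have "v \<in> X" "c v \<notin> A" using that A_F by (auto simp: U_def)
    then obtain u where "u \<in> Z" "E v u"
      using not_A_has_neighbor[OF _ _ i0_A] by (auto simp: Z_def)
    then have "{w \<in> Z. E v w} \<noteq> {}" by auto
    then show ?thesis
      using fin by (simp add: D_def Suc_le_eq card_gt_0_iff)
  qed
  \<comment> \<open>The left side is 1 if \<open>v\<close> has exactly one neighbor in
    \<open>Z\<close> and at most 0 otherwise.\<close>
  have S: "2 - D v \<le> int (card {z \<in> Z. solo z v})" if "v \<in> U" for v
  proof (cases "D v = 1")
    case True
    then obtain z where z: "{w \<in> Z. E v w} = {z}"
      by (auto simp: D_def card_1_singleton_iff)
    then have "{z \<in> Z. solo z v} = {z}"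
      by (auto simp: solo_def Z_def[symmetric])
    then show ?thesis by (simp add: True)
  qed (use D1[OF that] in simp)
  have N: "int (card {z \<in> Z. E z v \<and> \<not> solo z v}) \<le> 2 * (D v - 1)" if "v \<in> U" for v
  proof (cases "D v = 1")
    case True
    then obtain z where "{w \<in> Z. E v w} = {z}"
      by (auto simp: D_def card_1_singleton_iff)
    moreover from this have "w = z" if "w \<in> Z" "E w v" for w
      using that E_sym by blast
    ultimately have "{z \<in> Z. E z v \<and> \<not> solo z v} = {}"
      by (auto simp: solo_def Z_def[symmetric])
    then show ?thesis by (simp only: card.empty True) simp
  next
    case False
    have "card {z \<in> Z. E z v \<and> \<not> solo z v} \<le> card {w \<in> Z. E v w}"
      using fin E_sym by (intro card_mono) auto
    then show ?thesis using False D1[OF that] by (simp add: D_def)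
  qed
  have "(\<Sum>z\<in>Z. card (solos (F - R) z)) = (\<Sum>v\<in>W. card {z \<in> Z. solo z v})"
    unfolding solos_def using sum_multicount_gen[OF fin(1,2), of solo] by (simp add: W_def conj_assoc)
  moreover have "(\<Sum>v\<in>W. 2 - D v) \<le> (\<Sum>v\<in>W. int (card {z \<in> Z. solo z v}))"
    using S by (intro sum_mono) (auto simp: W_def U_def)
  ultimately have 1: "(\<Sum>v\<in>W. 2 - D v) \<le> (\<Sum>z\<in>Z. int (card (solos (F - R) z)))"
    by (metis of_nat_sum)
  have "(\<Sum>z\<in>Z. card (nonsolos z)) = (\<Sum>v\<in>U. card {z \<in> Z. E z v \<and> \<not> solo z v})"
    unfolding nonsolos_def using sum_multicount_gen[OF fin(1,3), of "\<lambda>z v. E z v \<and> \<not> solo z v"]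
    by (simp add: U_def conj_assoc)
  moreover have "(\<Sum>v\<in>U. int (card {z \<in> Z. E z v \<and> \<not> solo z v})) \<le> (\<Sum>v\<in>U. 2 * (D v - 1))"
    using N by (intro sum_mono) auto
  ultimately have 2: "(\<Sum>z\<in>Z. int (card (nonsolos z))) \<le> 2 * (\<Sum>v\<in>U. D v - 1)"
    by (simp only: of_nat_sum[symmetric] sum_distrib_left[symmetric])
  have "(\<Sum>v\<in>U. D v - 1) \<le> (\<Sum>v\<in>{v \<in> X. c v \<notin> A}. D v - 1)"
  proof (rule sum_mono2)
    show "finite {v \<in> X. c v \<notin> A}" using finX by simp
    show "U \<subseteq> {v \<in> X. c v \<notin> A}" using A_F by (auto simp: U_def)
    fix v assume "v \<in> {v \<in> X. c v \<notin> A} - U"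
    then obtain u where "u \<in> Z" "E v u"
      using not_A_has_neighbor[OF _ _ i0_A] by (auto simp: Z_def)
    then have "{w \<in> Z. E v w} \<noteq> {}" by auto
    then show "0 \<le> D v - 1"
      using fin by (simp add: D_def Suc_le_eq card_gt_0_iff)
  qed
  then have 3: "(\<Sum>v\<in>U. D v - 1) \<le> a * int s"
    using excess_le by (simp add: D_def Z_def a_def)
  have 4: "(\<Sum>v\<in>W. D v - 1) \<le> (\<Sum>v\<in>U. D v - 1)"
  proof (rule sum_mono2[OF fin(3)])
    show "W \<subseteq> U" by (auto simp: W_def U_def)
    show "0 \<le> D v - 1" if "v \<in> U - W" for v
      using D1[of v] that by auto
  qed
  have "F - R \<subseteq> {..<k} - A" using F_sub by auto
  then have "card W = card (F - R) * (s + 1)"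
    unfolding W_def by (rule card_colors_not_A)
  moreover have "int (card (F - R)) = f - \<rho>"
    using R finF by (simp add: card_Diff_subset finite_subset f_def \<rho>_def card_mono of_nat_diff)
  ultimately have cW: "int (card W) = (f - \<rho>) * (int s + 1)"
    by (simp add: distrib_left)
  have \<rho>: "\<rho> \<le> f"
    using R finF by (simp add: f_def \<rho>_def card_mono)
  have a0: "0 \<le> a" by (simp add: a_def)
  have "(\<Sum>v\<in>W. 2 - D v) = (\<Sum>v\<in>W. 1 - (D v - 1))"
    by (intro sum.cong) auto
  also have "\<dots> = int (card W) - (\<Sum>v\<in>W. D v - 1)"
    by (simp add: sum_subtractf)
  finally have "(f - \<rho>) * (int s + 1) - a * int s \<le> (\<Sum>z\<in>Z. int (card (solos (F - R) z)))"
    using 1 3 4 cW by linarith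
  \<comment> \<open>Lowering \<open>s + 1\<close> to \<open>s\<close> makes the bound a multiple of
    \<open>s\<close>, the size of \<open>Z\<close>.\<close>
  moreover have "(f - \<rho>) * int s \<le> (f - \<rho>) * (int s + 1)"
    using \<rho> by (intro mult_left_mono) auto
  ultimately have "(f - \<rho>) * int s - a * int s \<le> (\<Sum>z\<in>Z. int (card (solos (F - R) z)))"
    by linarith
  then have 5: "a * ((f - \<rho>) * int s - a * int s) \<le> a * (\<Sum>z\<in>Z. int (card (solos (F - R) z)))"
    using a0 by (rule mult_left_mono)
  have 6: "int d * (\<Sum>z\<in>Z. int (card (nonsolos z))) \<le> int d * (2 * (a * int s))"
    using 2 3 by (intro mult_left_mono) auto
  have "(\<Sum>z\<in>Z. a * int (card (solos (F - R) z)) - int d * int (card (nonsolos z))) < (\<Sum>z\<in>Z. K)"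
    using small fin i0(2) s_pos by (intro sum_strict_mono) (auto simp: Z_def)
  then have "a * (\<Sum>z\<in>Z. int (card (solos (F - R) z))) - int d * (\<Sum>z\<in>Z. int (card (nonsolos z))) < int s * K"
    using i0(2) by (simp add: sum_subtractf sum_distrib_left Z_def)
  then have "a * ((f - \<rho>) * int s - a * int s) - int d * (2 * (a * int s)) < int s * K"
    using 5 6 by linarith
  then show False
    by (simp add: K_def algebra_simps)
qed

section \<open>Cliques of solo neighbors and the contradiction\<close>

lemma clique_le:
  assumes "Q \<subseteq> V" "\<And>u v. u \<in> Q \<Longrightarrow> v \<in> Q \<Longrightarrow> u \<noteq> v \<Longrightarrow> E u v"
  shows "card Q \<le> d + 1"
proof (rule clique_card_le[OF _ irrE _ assms(2)])
  show "finite Q" using assms finV finite_subset by blast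
  show "\<exists>v\<in>W. card {u \<in> W. E v u} \<le> d" if "W \<subseteq> Q" "W \<noteq> {}" for W
    using degen[of W] that assms(1) by blast
qed

text \<open>A class with only one neighbor of \<open>z\<close> contributes a non-solo neighbor or a
  member of \<open>P\<close>. The vertices of \<open>P\<close> are adjacent to all other solo
  neighbors in \<open>F\<close>, so there are at most \<open>d\<close> of them.\<close>

lemma hit_colors_le:
  assumes z: "z \<in> cls X c i0" and many: "d + 2 \<le> card (solos F z)"
  shows "2 * card {j \<in> F. \<exists>u\<in>cls X c j. E z u} \<le> k + d + card (nonsolos z)"
proof -
  define P where "P = {v \<in> solos F z. \<forall>u\<in>cls X c (c v). E z u \<longrightarrow> u = v}"
  define H where "H = {j \<in> F. \<exists>u\<in>cls X c j. E z u}"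
  define N where "N = {v \<in> X. E z v}"
  have fin: "finite P" "finite H" "finite N" "finite (nonsolos z)" "finite (solos F z)"
    using finX finF by (auto simp: P_def H_def N_def nonsolos_def solos_def)
  have adj: "E y y'" if "y \<in> P" "y' \<in> solos F z" "y \<noteq> y'" for y y'
    using that private_solo_adjacent[of y z y'] by (auto simp: P_def solos_def)
  have "card P \<le> d"
  proof (rule ccontr)
    assume "\<not> card P \<le> d"
    then obtain Q where Q: "Q \<subseteq> P" "card Q = d + 1"
      using obtain_subset_with_card_n[of "d + 1" P] by auto
    then have fQ: "finite Q" using fin finite_subset by blast
    \<comment> \<open>\<open>many\<close> supplies a solo neighbor outside \<open>Q\<close>, which
      extends \<open>Q\<close> to a clique of \<open>d + 2\<close> vertices.\<close>
    have "\<not> solos F z \<subseteq> Q"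
      using many Q(2) card_mono[OF fQ, of "solos F z"] by auto
    then obtain w where w: "w \<in> solos F z" "w \<notin> Q" by auto
    have "card (insert w Q) \<le> d + 1"
    proof (rule clique_le)
      show "insert w Q \<subseteq> V"
        using w Q by (auto simp: P_def solos_def V)
      have QP: "v \<in> P \<and> v \<in> solos F z" if "v \<in> Q" for v
        using that Q by (auto simp: P_def)
      show "E u v" if "u \<in> insert w Q" "v \<in> insert w Q" "u \<noteq> v" for u v
        using that adj E_sym QP w by (metis insertE)
    qed
    with w Q fQ show False by simp
  qed
  have "(2::nat) \<le> card {v \<in> N. c v = j} + card {v \<in> P. c v = j} + card {v \<in> nonsolos z. c v = j}"
    if j: "j \<in> H" for j
  proof -
    obtain u where u: "u \<in> X" "c u = j" "E z u"
      using j by (auto simp: H_def cls_def)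
    then have uN: "u \<in> {v \<in> N. c v = j}" by (simp add: N_def)
    show ?thesis
    proof (cases "{v \<in> N. c v = j} = {u}")
      case True
      then have "u \<in> P \<or> u \<in> nonsolos z"
        using u j by (auto simp: P_def solos_def nonsolos_def H_def cls_def N_def)
      then have "{v \<in> P. c v = j} \<noteq> {} \<or> {v \<in> nonsolos z. c v = j} \<noteq> {}"
        using u by auto
      then have "1 \<le> card {v \<in> P. c v = j} \<or> 1 \<le> card {v \<in> nonsolos z. c v = j}"
        using fin by (auto simp: Suc_le_eq card_gt_0_iff)
      then show ?thesis using True by auto
    next
      case False
      then obtain u' where "u' \<in> {v \<in> N. c v = j}" "u' \<noteq> u" using uN by auto
      then have "card {u, u'} \<le> card {v \<in> N. c v = j}"
        using uN fin by (intro card_mono) auto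
      then show ?thesis using \<open>u' \<noteq> u\<close> by simp
    qed
  qed
  then have "(\<Sum>j\<in>H. 2) \<le> (\<Sum>j\<in>H. card {v \<in> N. c v = j} + card {v \<in> P. c v = j} + card {v \<in> nonsolos z. c v = j})"
    by (intro sum_mono)
  also have "\<dots> \<le> card N + card P + card (nonsolos z)"
    unfolding sum.distrib using sum_card_fibres_le fin by (intro add_mono) auto
  finally have "2 * card H \<le> card N + card P + card (nonsolos z)"
    by simp
  moreover have "card N \<le> k"
  proof -
    have "card N \<le> card {u \<in> V. E z u}"
      using finV by (intro card_mono) (auto simp: N_def V)
    moreover have "z \<in> V" using z by (auto simp: cls_def V)
    ultimately show ?thesis using deg[of z] by linarith
  qed
  ultimately show ?thesis
    using \<open>card P \<le> d\<close> by (simp add: H_def)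
qed

lemma not_stuck: False
proof -
  define a f T where "a = real (card A)" and "f = real (card F)" and "T = 1.36 * real d - 1.15 * a"
  have a: "1 \<le> a" "a \<le> d"
    using card_A by (auto simp: a_def)
  have dk': "d \<le> k" using dk by simp
  have fk: "f = real k - real d"
    using F(2) dk' by (simp add: f_def)
  have f: "5.21 * real d \<le> f"
    using dk fk by simp
  have T0: "0 \<le> T" "3 * T < f"
    using a f by (auto simp: T_def)
  have dich: "card S \<le> T \<or> f - card S \<le> T" if "in_closed S" for S
  proof -
    have "card S \<le> card F"
      using that finF by (auto simp: in_closed_def intro: card_mono)
    moreover have "real (card S * (card F - card S) + card A * card F) \<le> real (d * (card F + card A))"
      using in_closed_edges[OF that] by (simp only: of_nat_le_iff)
    ultimately have "real (card S) * (f - card S) + a * f \<le> real d * (f + a)"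
      by (simp add: a_def f_def of_nat_diff)
    then show ?thesis
      using in_closed_dichotomy[OF a f] by (simp add: T_def)
  qed
  have "\<exists>R. (in_closed R \<and> card R \<le> T) \<and> (\<forall>S. in_closed S \<and> card S \<le> T \<longrightarrow> card S \<le> card R)"
  proof (rule ex_has_greatest_nat[of _ "{}" _ "Suc (card F)"])
    show "in_closed {} \<and> card ({} :: nat set) \<le> T"
      using T0 by (simp add: in_closed_def)
    show "\<forall>S. in_closed S \<and> card S \<le> T \<longrightarrow> card S < Suc (card F)"
      using finF by (auto simp: in_closed_def less_Suc_eq_le intro: card_mono)
  qed
  then obtain R where R: "in_closed R" "card R \<le> T"
    and Rmax: "\<And>S. in_closed S \<Longrightarrow> card S \<le> T \<Longrightarrow> card S \<le> card R" by blast
  have RF: "R \<subseteq> F" and finR: "finite R"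
    using R finF finite_subset by (auto simp: in_closed_def)
  \<comment> \<open>The union with \<open>R\<close> has at most \<open>2 * T\<close> classes, fewer
    than \<open>f - T\<close>, so by \<open>dich\<close> it has at most \<open>T\<close>, and
    \<open>R\<close> was largest.\<close>
  have RS: "S \<subseteq> R" if S: "in_closed S" "card S \<le> T" for S
  proof -
    have finS: "finite S"
      using S finF finite_subset by (auto simp: in_closed_def)
    have ic: "in_closed (R \<union> S)"
      using S R by (auto simp: in_closed_def)
    have "card (R \<union> S) \<le> card R + card S"
      by (rule card_Un_le)
    then have "card (R \<union> S) \<le> T"
      using dich[OF ic] S R T0 by linarith
    then have "card (R \<union> S) \<le> card R"
      by (rule Rmax[OF ic])
    then have "R \<union> S = R"
      using finR finS card_seteq[of "R \<union> S" R] by auto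
    then show ?thesis by auto
  qed
  obtain z where z: "z \<in> cls X c i0"
    and w: "int (card A) * (int (card F) - int (card R) - int (card A) - 2 * int d) \<le>
      int (card A) * int (card (solos (F - R) z)) - int d * int (card (nonsolos z))"
    using exists_good_center[OF RF] by blast
  define y u where "y = real (card (solos (F - R) z))" and "u = real (card (nonsolos z))"
  define \<rho> where "\<rho> = real (card R)"
  have w': "a * (f - \<rho> - a - 2 * d) \<le> a * y - d * u"
  proof -
    have "real_of_int (int (card A) * (int (card F) - int (card R) - int (card A) - 2 * int d)) \<le>
      real_of_int (int (card A) * int (card (solos (F - R) z)) - int d * int (card (nonsolos z)))"
      using w by (simp only: of_int_le_iff)
    then show ?thesis by (simp add: a_def f_def \<rho>_def y_def u_def)
  qed
  have "0 \<le> d * u" by (simp add: u_def)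
  then have "a * (f - \<rho> - a - 2 * d) \<le> a * y" using w' by linarith
  then have "f - \<rho> - a - 2 * d \<le> y" using a by simp
  \<comment> \<open>The estimates give at least \<open>1.85 * d + 0.15 * a\<close>, which for
    \<open>d = 1\<close> only equals \<open>d + 1\<close>; there the integrality of \<open>k\<close>
    yields \<open>7 \<le> k\<close>.\<close>
  moreover have "real d + 1 < f - \<rho> - a - 2 * d"
  proof (cases "d = 1")
    case True
    then have "7 \<le> k" using dk by simp
    then show ?thesis using True R(2) a by (simp add: T_def fk \<rho>_def)
  next
    case False
    then have "2 \<le> real d" using d by simp
    then show ?thesis using R(2) a f by (simp add: T_def \<rho>_def)
  qed
  ultimately have y: "d + 2 \<le> card (solos (F - R) z)"
    by (simp add: y_def)
  have fs: "finite (solos S z)" for S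
    using finX by (simp add: solos_def)
  have "card (solos (F - R) z) \<le> card (solos F z)"
    using fs by (intro card_mono) (auto simp: solos_def)
  then have hit: "2 * card {j \<in> F. \<exists>u\<in>cls X c j. E z u} \<le> k + d + card (nonsolos z)"
    using hit_colors_le[OF z] y by simp
  \<comment> \<open>\<open>Z0\<close> consists of the classes of \<open>F\<close> that avoid
    \<open>z\<close>, and \<open>D\<close> of all those they reach within \<open>F\<close>; hence no
    class of \<open>D\<close> can enter \<open>F - D\<close>.\<close>
  define Z0 where "Z0 = {i \<in> F. \<forall>u\<in>cls X c i. \<not> E z u}"
  define D where "D = {j \<in> F. \<exists>i\<in>Z0. mvF\<^sup>*\<^sup>* i j}"
  have "in_closed (F - D)"
    unfolding in_closed_def
  proof (intro conjI ballI notI)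
    fix i j assume ij: "i \<in> F - (F - D)" "j \<in> F - D" "mv i j"
    then have "mvF i j" by (auto simp: mvF_def)
    with ij show False
      by (auto simp: D_def intro: rtranclp.rtrancl_into_rtrancl)
  qed auto
  from dich[OF this] show False
  proof
    \<comment> \<open>Every class of \<open>F - R\<close> is now reached from \<open>Z0\<close>, so
      the solo neighbors of \<open>z\<close> there are pairwise adjacent.\<close>
    assume "card (F - D) \<le> T"
    then have FD: "F - D \<subseteq> R"
      using RS \<open>in_closed (F - D)\<close> by blast
    have "card (solos (F - R) z) \<le> d + 1"
    proof (rule clique_le)
      show "solos (F - R) z \<subseteq> V" by (auto simp: solos_def V)
      fix v v' assume v: "v \<in> solos (F - R) z" "v' \<in> solos (F - R) z" "v \<noteq> v'"
      then obtain i where "i \<in> Z0" "mvF\<^sup>*\<^sup>* i (c v)"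
        using FD by (auto simp: solos_def D_def)
      then show "E v v'"
        using v reached_solo_adjacent[of v z v' i] by (auto simp: solos_def Z0_def)
    qed
    with y show False by simp
  next
    \<comment> \<open>Now at most \<open>T\<close> classes of \<open>F\<close> avoid
      \<open>z\<close>, and \<open>hit\<close> forces many non-solo neighbors.\<close>
    assume h: "f - card (F - D) \<le> T"
    have "Z0 \<subseteq> D" by (auto simp: D_def Z0_def)
    moreover have "D \<subseteq> F" by (auto simp: D_def)
    ultimately have "card Z0 \<le> card D" "card D \<le> card F" "card (F - D) = card F - card D"
      using finF by (auto intro!: card_mono card_Diff_subset intro: finite_subset)
    then have "card Z0 \<le> T"
      using h by (simp add: f_def of_nat_diff)
    moreover have "{j \<in> F. \<exists>u\<in>cls X c j. E z u} = F - Z0"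
      by (auto simp: Z0_def)
    moreover have "card (F - Z0) = card F - card Z0" "card Z0 \<le> card F"
      using finF by (auto simp: Z0_def intro!: card_Diff_subset card_mono)
    ultimately have "2 * (f - T) \<le> real k + real d + u"
      using hit by (simp add: f_def u_def of_nat_diff)
    then have u: "f - 2 * T - 2 * real d \<le> u"
      using fk by simp
    have "card (solos (F - R) z) + card (nonsolos z) = card (solos (F - R) z \<union> nonsolos z)"
      using finX by (intro card_Un_disjoint[symmetric]) (auto simp: solos_def nonsolos_def)
    also have "\<dots> \<le> card {u \<in> V. E z u}"
      using finV E_sym solo_memD by (intro card_mono) (auto simp: solos_def nonsolos_def V)
    also have "\<dots> \<le> k"
      using z by (intro deg) (auto simp: cls_def V)
    finally have "y + u \<le> f + d"
      using fk by (simp add: y_def u_def)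
    then have "a * (y + u) \<le> a * (f + d)"
      using a by (intro mult_left_mono) auto
    \<comment> \<open>\<open>y\<close> is eliminated between \<open>w'\<close> and the degree bound
      \<open>y + u \<le> f + d\<close>.\<close>
    then have "(a + real d) * u \<le> a * (3 * real d + \<rho> + a)"
      using w' by (simp add: algebra_simps)
    then show False
      using weight_contradiction[OF a f T_def _ u] R(2) by (simp add: \<rho>_def)
  qed
qed

end

subsection \<open>Adding a vertex of small degree\<close>

text \<open>With \<open>s\<close> the smallest class size, enlarging a class of size
  \<open>s\<close> by one keeps all sizes in \<open>s\<close> and \<open>s + 1\<close>, so a
  coloring that cannot be extended is stuck. The neighbors of \<open>x\<close> meet at most
  \<open>d\<close> classes, which leaves enough for \<open>F\<close>.\<close>

lemma equitable_coloring_insert: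
  fixes V :: "'a set" and E :: "'a \<Rightarrow> 'a \<Rightarrow> bool" and d k :: nat
  assumes finV: "finite V" and symE: "symp E" and irrE: "irreflp E"
    and deg: "\<And>v. v \<in> V \<Longrightarrow> card {u \<in> V. E v u} \<le> k"
    and degen: "\<And>W. W \<subseteq> V \<Longrightarrow> W \<noteq> {} \<Longrightarrow> \<exists>v\<in>W. card {u \<in> W. E v u} \<le> d"
    and d: "1 \<le> d" and dk: "6.21 * real d \<le> real k"
    and V: "V = insert x X" and x: "x \<notin> X"
    and degx: "card {u \<in> V. E x u} \<le> d"
    and eq: "equitable_coloring X E k c"
  shows "\<exists>c'. equitable_coloring V E k c'"
proof (rule ccontr)
  assume n: "\<not> ?thesis"
  have k: "0 < k" using d dk by (cases k) auto
  have pc: "proper X E k c"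
    using eq by (simp add: equitable_coloring_def proper_def)
  define s where "s = Min ((\<lambda>m. card (cls X c m)) ` {..<k})"
  have "s \<in> (\<lambda>m. card (cls X c m)) ` {..<k}"
    unfolding s_def using k by (intro Min_in) auto
  then obtain i0 where i0: "i0 < k" "card (cls X c i0) = s" by auto
  have size: "s \<le> card (cls X c m) \<and> card (cls X c m) \<le> s + 1" if "m < k" for m
  proof
    show "s \<le> card (cls X c m)"
      unfolding s_def using that by (intro Min_le) auto
    show "card (cls X c m) \<le> s + 1"
      using eq that i0 by (auto simp: equitable_coloring_def cls_def)
  qed
  define F0 where "F0 = {i. i < k \<and> (\<forall>u\<in>cls X c i. \<not> E x u)}"
  have "card ({..<k} - F0) \<le> d"
  proof -
    have "{..<k} - F0 \<subseteq> c ` {u \<in> V. E x u}"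
      by (auto simp: F0_def cls_def V)
    then have "card ({..<k} - F0) \<le> card {u \<in> V. E x u}"
      using finV by (intro surj_card_le) auto
    then show ?thesis using degx by simp
  qed
  moreover have "card ({..<k} - F0) = k - card F0"
    by (subst card_Diff_subset) (auto simp: F0_def)
  ultimately have "k - d \<le> card F0" by simp
  then obtain F where F: "F \<subseteq> F0" "card F = k - d"
    using obtain_subset_with_card_n by metis
  have st: False if "proper V E k c'" "j < k" "card (cls X c j) = s"
    "\<And>m. card (cls V c' m) = card (cls X c m) + of_bool (j = m)" for c' j
  proof -
    have "s \<le> card (cls V c' m) \<and> card (cls V c' m) \<le> s + 1" if "m < k" for m
      using size[OF that] \<open>card (cls X c j) = s\<close> that \<open>\<And>m. card (cls V c' m) = _\<close>[of m] by auto
    then have "card (cls V c' i) \<le> card (cls V c' j) + 1" if "i < k" "j < k" for i j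
      using that by (meson add_le_mono1 le_trans)
    then have "equitable_coloring V E k c'"
      using that(1) by (auto simp: equitable_coloring_def proper_def cls_def)
    with n show False by blast
  qed
  interpret stuck_coloring V E d k s x c X F i0
    by (rule stuck_coloring.intro) (fact finV symE irrE deg degen d dk V x degx pc size i0 F[unfolded F0_def] st)+
  show False by (rule not_stuck)
qed

theorem theorem3:
  fixes V :: "'a set" and E :: "'a \<Rightarrow> 'a \<Rightarrow> bool" and d D :: nat
  assumes "d \<ge> 1"
    and "real D \<ge> 6.21 * real d"
    and "simple_graph V E"
    and "degenerate d V E"
    and "max_degree_le V E D"
  shows "\<exists>c. equitable_coloring V E D c"
proof -
  have finV: "finite V" and sym: "symp E" and irr: "irreflp E"
    using assms(3) by (auto simp: simple_graph_def symp_def irreflp_def)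
  have degen: "\<exists>v\<in>W. card {u \<in> W. E v u} \<le> d" if W: "W \<subseteq> V" "W \<noteq> {}" for W
  proof -
    let ?F = "\<lambda>u v. E u v \<and> u \<in> W \<and> v \<in> W"
    have "subgraph W ?F V E"
      using W assms(3) finite_subset by (auto simp: subgraph_def simple_graph_def)
    then obtain v where "v \<in> W" "degree W ?F v \<le> d"
      using assms(4) W(2) unfolding degenerate_def by blast
    moreover have "{u \<in> W. ?F v u} = {u \<in> W. E v u}"
      using \<open>v \<in> W\<close> by auto
    ultimately show ?thesis by (auto simp: degree_def)
  qed
  \<comment> \<open>The induction removes a vertex of degree at most \<open>d\<close> from
    \<open>S\<close>; the number \<open>D\<close> of colors stays fixed.\<close>
  have "\<exists>c. equitable_coloring S E D c" if "finite S" "S \<subseteq> V" for S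
    using that
  proof (induction "card S" arbitrary: S)
    case 0
    then show ?case by (auto simp: equitable_coloring_def)
  next
    case (Suc n)
    then have "S \<noteq> {}" by auto
    then obtain x where x: "x \<in> S" "card {u \<in> S. E x u} \<le> d"
      using degen Suc.prems by blast
    obtain c where c: "equitable_coloring (S - {x}) E D c"
      using Suc.hyps(1)[of "S - {x}"] Suc.hyps(2) Suc.prems x(1)
      by (metis Diff_subset card_Diff_singleton diff_Suc_1 finite_Diff subset_trans)
    show ?case
    proof (rule equitable_coloring_insert[OF Suc.prems(1) sym irr _ _ assms(1,2) _ _ x(2) c])
      show "card {u \<in> S. E v u} \<le> D" if "v \<in> S" for v
      proof -
        have "card {u \<in> S. E v u} \<le> card {u \<in> V. E v u}"
          using finV Suc.prems(2) by (intro card_mono) auto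
        then show ?thesis
          using assms(5) that Suc.prems(2) by (force simp: max_degree_le_def degree_def)
      qed
      show "\<exists>v\<in>W. card {u \<in> W. E v u} \<le> d" if "W \<subseteq> S" "W \<noteq> {}" for W
        using degen[of W] that Suc.prems(2) by blast
    qed (use x in auto)
  qed
  then show ?thesis using finV by blast
qed

end
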